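(* Let $R$ be a commutative ring of Krull dimension at most $1$ such that $\operatorname{mSpec}R$ (with the Zariski topology) is a Noetherian space, and let $A$ be an $R$-algebra which is finitely generated as an $R$-module. Let $h$ be the smallest non-negative integer such that $h\ge r_{\mathfrak p}$ for all but finitely many maximal ideals $\mathfrak p$ of $R$. If $k$ is an integer with $k\ge r_{\mathfrak p}$ for all maximal ideals $\mathfrak p$ and $k\ge 1+h$, then $A$ can be generated by $k$ elements as an $R$-algebra.
   Context: Algebras are associative and unital; elements generate an algebra if the non-commutative monomials in them (including $1$) span it as a module. For a prime ideal $\mathfrak p$, $\kappa(\mathfrak p)=R_{\mathfrak p}/\mathfrak pR_{\mathfrak p}$ and $r_{\mathfrak p}$ is the smallest number of generators of the $\kappa(\mathfrak p)$-algebra $A\otimes_R\kappa(\mathfrak p)$. *)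

theory Defs
  imports Main
begin

definition ring_ideal :: "'r::comm_ring_1 set \<Rightarrow> bool" where
  "ring_ideal I \<longleftrightarrow> 0 \<in> I \<and> (\<forall>x\<in>I. \<forall>y\<in>I. x + y \<in> I) \<and> (\<forall>x\<in>I. - x \<in> I)
     \<and> (\<forall>r x. x \<in> I \<longrightarrow> r * x \<in> I)"

definition prime_ideal :: "'r::comm_ring_1 set \<Rightarrow> bool" where
  "prime_ideal P \<longleftrightarrow> ring_ideal P \<and> P \<noteq> UNIV \<and> (\<forall>a b. a * b \<in> P \<longrightarrow> a \<in> P \<or> b \<in> P)"

definition maximal_ideal :: "'r::comm_ring_1 set \<Rightarrow> bool" where
  "maximal_ideal M \<longleftrightarrow> ring_ideal M \<and> M \<noteq> UNIV \<and>
     (\<forall>J. ring_ideal J \<and> M \<subseteq> J \<longrightarrow> J = M \<or> J = UNIV)"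

definition krull_dim_le_1 :: "'r::comm_ring_1 itself \<Rightarrow> bool" where
  "krull_dim_le_1 _ \<longleftrightarrow>
     \<not> (\<exists>P Q S :: 'r set. prime_ideal P \<and> prime_ideal Q \<and> prime_ideal S \<and> P \<subset> Q \<and> Q \<subset> S)"

definition mSpec :: "'r::comm_ring_1 set set" where
  "mSpec = {M. maximal_ideal M}"

definition mSpec_closed :: "'r::comm_ring_1 set set \<Rightarrow> bool" where
  "mSpec_closed C \<longleftrightarrow> (\<exists>S. C = {M \<in> mSpec. S \<subseteq> M})"

definition mSpec_noetherian :: "'r::comm_ring_1 itself \<Rightarrow> bool" where
  "mSpec_noetherian _ \<longleftrightarrow>
     (\<forall>C :: nat \<Rightarrow> 'r set set. (\<forall>n. mSpec_closed (C n)) \<and> (\<forall>n. C (Suc n) \<subseteq> C n)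
        \<longrightarrow> (\<exists>N. \<forall>n\<ge>N. C n = C N))"

text \<open>An (associative, unital) R-algebra structure on a ring A: a unital ring homomorphism
  into the centre of A; the scalar action is  r \<cdot> x = phi r * x.\<close>
definition is_algebra_map :: "('r::comm_ring_1 \<Rightarrow> 'a::ring_1) \<Rightarrow> bool" where
  "is_algebra_map phi \<longleftrightarrow> phi 1 = 1 \<and> (\<forall>a b. phi (a + b) = phi a + phi b)
     \<and> (\<forall>a b. phi (a * b) = phi a * phi b) \<and> (\<forall>r x. phi r * x = x * phi r)"

definition rspan :: "('r::comm_ring_1 \<Rightarrow> 'a::ring_1) \<Rightarrow> 'a set \<Rightarrow> 'a set" where
  "rspan phi S = {sum_list (map (\<lambda>(c, x). phi c * x) l) | l. \<forall>(c, x) \<in> set l. x \<in> S}"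

definition finitely_generated_module :: "('r::comm_ring_1 \<Rightarrow> 'a::ring_1) \<Rightarrow> bool" where
  "finitely_generated_module phi \<longleftrightarrow> (\<exists>S. finite S \<and> rspan phi S = UNIV)"

definition monomials :: "'a::ring_1 list \<Rightarrow> 'a set" where
  "monomials as = {prod_list w | w. set w \<subseteq> set as}"

definition generates_algebra :: "('r::comm_ring_1 \<Rightarrow> 'a::ring_1) \<Rightarrow> 'a list \<Rightarrow> bool" where
  "generates_algebra phi as \<longleftrightarrow> rspan phi (monomials as) = UNIV"

definition ideal_times :: "('r::comm_ring_1 \<Rightarrow> 'a::ring_1) \<Rightarrow> 'r set \<Rightarrow> 'a set" where
  "ideal_times phi P = {sum_list (map (\<lambda>(c, x). phi c * x) l) | l. \<forall>(c, x) \<in> set l. c \<in> P}"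

text \<open>For a maximal ideal p, \<kappa>(p) = R/p and A \<otimes>_R \<kappa>(p) = A/pA. Elements of A/pA generate it as
  a \<kappa>(p)-algebra iff lifts a_i in A satisfy  span_R(monomials a) + pA = A.\<close>
definition generates_fibre :: "('r::comm_ring_1 \<Rightarrow> 'a::ring_1) \<Rightarrow> 'r set \<Rightarrow> 'a list \<Rightarrow> bool" where
  "generates_fibre phi P as \<longleftrightarrow>
     (\<forall>x. \<exists>y z. y \<in> rspan phi (monomials as) \<and> z \<in> ideal_times phi P \<and> x = y + z)"

definition fibre_rank :: "('r::comm_ring_1 \<Rightarrow> 'a::ring_1) \<Rightarrow> 'r set \<Rightarrow> nat" where
  "fibre_rank phi P = (LEAST n. \<exists>as. length as = n \<and> generates_fibre phi P as)"

end

theory Submission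
  imports Defs
begin

text \<open>
  For a tuple \<open>a\<close> in \<open>A\<close> and a maximal ideal \<open>p\<close>, let \<open>e\<^sub>p(a)\<close> be the number of further elements
  needed to make \<open>a\<close> generate the fibre \<open>A/pA\<close>. Clearing denominators in Nakayama's lemma shows
  that \<open>{p. e\<^sub>p(a) \<le> n}\<close> is open in \<open>mSpec R\<close>. As \<open>R\<close> has dimension at most one and \<open>mSpec R\<close> is
  Noetherian, there are finitely many maximal ideals, avoiding any prescribed finite set, such
  that every open set containing them is cofinite.

  The generators are chosen one at a time, keeping \<open>e\<^sub>p \<le> m\<close> everywhere and \<open>e\<^sub>p \<le> n\<close> almost
  everywhere, where \<open>n < m\<close> (or \<open>n = 0\<close>, which is then kept). By the Chinese remainder theorem the next element can be chosen to
  lower \<open>e\<^sub>p\<close> both at the finitely many exceptional points, where \<open>e\<^sub>p > n\<close>, and at finitely many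
  points that detect cofiniteness. Then \<open>e\<^sub>p \<le> m - 1\<close> everywhere, because \<open>n \<le> m - 1\<close>, and
  \<open>e\<^sub>p \<le> n - 1\<close> almost everywhere by openness.
\<close>

section \<open>Ideals and the maximal spectrum\<close>

lemma ring_idealD:
  assumes "ring_ideal I"
  shows "0 \<in> I" "x \<in> I \<Longrightarrow> y \<in> I \<Longrightarrow> x + y \<in> I" "x \<in> I \<Longrightarrow> - x \<in> I" "x \<in> I \<Longrightarrow> r * x \<in> I"
  using assms unfolding ring_ideal_def by auto

lemma ring_ideal_mult_right: "ring_ideal I \<Longrightarrow> x \<in> I \<Longrightarrow> x * r \<in> I"
  using ring_idealD(4)[of I x r] by (simp add: mult.commute)

lemma ring_ideal_eq_UNIV_iff: "ring_ideal I \<Longrightarrow> I = UNIV \<longleftrightarrow> 1 \<in> I"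
  using ring_idealD(4)[of I 1] by auto

lemma maximal_ideal_one_notin: "maximal_ideal M \<Longrightarrow> 1 \<notin> M"
  unfolding maximal_ideal_def using ring_ideal_eq_UNIV_iff by auto

text \<open>The ideal \<open>M + R x\<close> properly contains \<open>M\<close>, so it contains 1;
  this yields an inverse of \<open>x\<close> modulo \<open>M\<close>.\<close>

lemma maximal_ideal_inverse:
  assumes M: "maximal_ideal M" and x: "x \<notin> M"
  obtains y where "1 - y * x \<in> M"
proof -
  let ?J = "{m + r * x | m r. m \<in> M}"
  have I: "ring_ideal M" using M unfolding maximal_ideal_def by auto
  have "ring_ideal ?J"
    unfolding ring_ideal_def
  proof (intro conjI ballI allI impI)
    show "0 \<in> ?J" using ring_idealD(1)[OF I] by (auto intro!: exI[of _ 0])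
  next
    fix a b assume "a \<in> ?J" "b \<in> ?J"
    then obtain m r m' r' where "a = m + r * x" "b = m' + r' * x" "m \<in> M" "m' \<in> M" by blast
    then have "a + b = (m + m') + (r + r') * x" "m + m' \<in> M"
      using ring_idealD(2)[OF I] by (auto simp: algebra_simps)
    then show "a + b \<in> ?J" by blast
  next
    fix a assume "a \<in> ?J"
    then obtain m r where "a = m + r * x" "m \<in> M" by blast
    then have "- a = (- m) + (- r) * x" "- m \<in> M"
      using ring_idealD(3)[OF I] by (auto simp: algebra_simps)
    then show "- a \<in> ?J" by blast
  next
    fix c a assume "a \<in> ?J"
    then obtain m r where "a = m + r * x" "m \<in> M" by blast
    then have "c * a = (c * m) + (c * r) * x" "c * m \<in> M"
      using ring_idealD(4)[OF I, of m c] by (simp_all add: distrib_left mult.assoc)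
    then show "c * a \<in> ?J" by blast
  qed
  moreover have "M \<subseteq> ?J"
  proof
    fix m assume "m \<in> M"
    then have "m = m + 0 * x \<and> m \<in> M" by simp
    then show "m \<in> ?J" by blast
  qed
  moreover have "x \<in> ?J"
  proof -
    have "x = 0 + 1 * x \<and> 0 \<in> M" using ring_idealD(1)[OF I] by simp
    then show ?thesis by blast
  qed
  ultimately have "?J = UNIV" using M x unfolding maximal_ideal_def by blast
  then have "1 \<in> ?J" by blast
  then obtain m r where "1 = m + r * x" "m \<in> M" by blast
  then have "1 - r * x \<in> M" by (metis add_diff_cancel_right')
  then show thesis by (rule that)
qed

lemma maximal_ideal_imp_prime:
  assumes M: "maximal_ideal M" shows "prime_ideal M"
  unfolding prime_ideal_def
proof (intro conjI allI impI)
  show I: "ring_ideal M" and "M \<noteq> UNIV" using M unfolding maximal_ideal_def by auto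
  fix a b assume ab: "a * b \<in> M"
  show "a \<in> M \<or> b \<in> M"
  proof (rule disjCI)
    assume "b \<notin> M"
    then obtain y where y: "1 - y * b \<in> M" using maximal_ideal_inverse[OF M] by blast
    have "a = a * (1 - y * b) + y * (a * b)" by (simp add: algebra_simps)
    then show "a \<in> M"
      using ring_idealD(2)[OF I ring_idealD(4)[OF I y, of a] ring_idealD(4)[OF I ab, of y]] by simp
  qed
qed

lemma maximal_ideal_eqI: "maximal_ideal M \<Longrightarrow> maximal_ideal M' \<Longrightarrow> M \<subseteq> M' \<Longrightarrow> M = M'"
  unfolding maximal_ideal_def by metis

text \<open>Zorn's lemma applies to the ideals that contain \<open>I\<close> but not 1, since the
  union of a nonempty chain of them is another one.\<close>

lemma ex_maximal_ideal_superset: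
  assumes I: "ring_ideal I" and one: "1 \<notin> I"
  shows "\<exists>M. maximal_ideal M \<and> I \<subseteq> M"
proof -
  let ?A = "{J. ring_ideal J \<and> 1 \<notin> J \<and> I \<subseteq> J}"
  have "\<exists>M\<in>?A. \<forall>X\<in>?A. M \<subseteq> X \<longrightarrow> X = M"
  proof (rule subset_Zorn_nonempty)
    show "?A \<noteq> {}" using I one by blast
  next
    fix C assume ne: "C \<noteq> {}" and C: "subset.chain ?A C"
    then have sub: "\<And>J. J \<in> C \<Longrightarrow> ring_ideal J \<and> 1 \<notin> J \<and> I \<subseteq> J"
      and lin: "\<And>J K. J \<in> C \<Longrightarrow> K \<in> C \<Longrightarrow> J \<subseteq> K \<or> K \<subseteq> J"
      unfolding subset_chain_def by blast+
    have "ring_ideal (\<Union>C)"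
      unfolding ring_ideal_def
    proof (intro conjI ballI allI impI)
      show "0 \<in> \<Union>C" using ne sub ring_idealD(1) by blast
    next
      fix x y assume "x \<in> \<Union>C" "y \<in> \<Union>C"
      then obtain J K where JK: "J \<in> C" "K \<in> C" "x \<in> J" "y \<in> K" by blast
      then consider "x \<in> K" | "y \<in> J" using lin by blast
      then show "x + y \<in> \<Union>C" using JK sub ring_idealD(2) by cases blast+
    next
      fix x assume "x \<in> \<Union>C" then show "- x \<in> \<Union>C" using sub ring_idealD(3) by blast
    next
      fix r x assume "x \<in> \<Union>C" then show "r * x \<in> \<Union>C" using sub ring_idealD(4) by blast
    qed
    then show "\<Union>C \<in> ?A" using ne sub by blast
  qed
  then obtain M where "M \<in> ?A" and max_A: "\<forall>X\<in>?A. M \<subseteq> X \<longrightarrow> X = M" by (elim bexE)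
  then have M: "ring_ideal M" "1 \<notin> M" "I \<subseteq> M" by auto
  have max: "X = M" if "ring_ideal X" "1 \<notin> X" "M \<subseteq> X" for X
    using max_A that M(3) by auto
  have "maximal_ideal M"
    unfolding maximal_ideal_def
  proof (intro conjI allI impI)
    show "M \<noteq> UNIV" using M by blast
    fix J assume "ring_ideal J \<and> M \<subseteq> J"
    then show "J = M \<or> J = UNIV" using max[of J] M ring_ideal_eq_UNIV_iff[of J] by blast
  qed (rule M)
  then show ?thesis using M by blast
qed

lemma ring_ideal_Inter:
  assumes "\<And>M. M \<in> C \<Longrightarrow> ring_ideal M" shows "ring_ideal (\<Inter>C)"
  using assms unfolding ring_ideal_def by blast

section \<open>Closed subsets of the maximal spectrum\<close>

lemma mSpec_closed_Int_zeros: "mSpec_closed C \<Longrightarrow> mSpec_closed {M \<in> C. a \<in> M}"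
proof -
  assume "mSpec_closed C"
  then obtain S where "C = {M \<in> mSpec. S \<subseteq> M}" unfolding mSpec_closed_def by blast
  then have "{M \<in> C. a \<in> M} = {M \<in> mSpec. insert a S \<subseteq> M}" by auto
  then show ?thesis unfolding mSpec_closed_def by blast
qed

text \<open>A closed set is the zero set of the intersection of its members, so it can be handled
  through the ideal \<open>\<Inter>C\<close>.\<close>

lemma mSpec_closed_mem_iff:
  assumes "mSpec_closed C" shows "M \<in> C \<longleftrightarrow> M \<in> mSpec \<and> \<Inter>C \<subseteq> M"
proof -
  from assms obtain S where "C = {M \<in> mSpec. S \<subseteq> M}" unfolding mSpec_closed_def by blast
  then show ?thesis by blast
qed

lemma mSpec_closed_imp_maximal: "mSpec_closed C \<Longrightarrow> M \<in> C \<Longrightarrow> maximal_ideal M"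
  using mSpec_closed_mem_iff unfolding mSpec_def by blast

lemma mSpec_noetherian_induct [consumes 2, case_names less]:
  fixes C :: "'r::comm_ring_1 set set"
  assumes noeth: "mSpec_noetherian TYPE('r)" and C: "mSpec_closed C"
    and step: "\<And>C. mSpec_closed C \<Longrightarrow> (\<And>D. mSpec_closed D \<Longrightarrow> D \<subset> C \<Longrightarrow> P D) \<Longrightarrow> P C"
  shows "P C"
proof -
  let ?r = "{(D, C :: 'r set set). mSpec_closed D \<and> mSpec_closed C \<and> D \<subset> C}"
  have "wf ?r"
    unfolding wf_iff_no_infinite_down_chain
  proof
    assume "\<exists>f. \<forall>i. (f (Suc i), f i) \<in> ?r"
    then obtain f :: "nat \<Rightarrow> 'r set set"
      where f: "\<And>i. mSpec_closed (f i) \<and> f (Suc i) \<subset> f i" by blast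
    then have "\<exists>N. \<forall>n\<ge>N. f n = f N"
      using noeth unfolding mSpec_noetherian_def by blast
    then obtain N where "f (Suc N) = f N" by (meson le_SucI order_refl)
    then show False using f[of N] by blast
  qed
  then show ?thesis using C
  proof (induction C rule: wf_induct_rule)
    case (less C)
    show ?case
    proof (rule step[OF less.prems])
      fix D :: "'r set set" assume "mSpec_closed D" "D \<subset> C"
      then show "P D" using less.prems by (intro less.IH) simp_all
    qed
  qed
qed

text \<open>Primality of \<open>\<Inter>C\<close> is the algebraic form of irreducibility of
  \<open>C\<close>.\<close>

lemma prime_ideal_Inter_closed:
  assumes C: "mSpec_closed C" "C \<noteq> {}"
    and irred: "\<And>a b. a * b \<in> \<Inter>C \<Longrightarrow> a \<in> \<Inter>C \<or> b \<in> \<Inter>C"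
  shows "prime_ideal (\<Inter>C)"
proof -
  have "ring_ideal M" "1 \<notin> M" if "M \<in> C" for M
    using mSpec_closed_imp_maximal[OF C(1) that] maximal_ideal_one_notin
    unfolding maximal_ideal_def by auto
  then have "ring_ideal (\<Inter>C)" "1 \<notin> \<Inter>C" using C(2) by (auto intro: ring_ideal_Inter)
  then show ?thesis using irred unfolding prime_ideal_def by blast
qed

text \<open>A minimal infinite closed subset is irreducible: if \<open>a * b\<close> vanishes on it,
  it is the union of the zero sets of \<open>a\<close> and \<open>b\<close>, and these cannot both
  be proper, as proper closed subsets are finite.\<close>

lemma infinite_closed_contains_irreducible:
  fixes D :: "'r::comm_ring_1 set set"
  assumes noeth: "mSpec_noetherian TYPE('r)" and D: "mSpec_closed D" "infinite D"
  shows "\<exists>E\<subseteq>D. mSpec_closed E \<and> infinite E \<and> prime_ideal (\<Inter>E)"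
  using noeth D
proof (induction D rule: mSpec_noetherian_induct)
  case (less C)
  show ?case
  proof (cases "\<exists>D\<subset>C. mSpec_closed D \<and> infinite D")
    case True
    then obtain D where D: "D \<subset> C" "mSpec_closed D" "infinite D" by blast
    then obtain E where "E \<subseteq> D" "mSpec_closed E" "infinite E" "prime_ideal (\<Inter>E)"
      using less.IH[OF D(2,1,3)] by blast
    then show ?thesis using D(1) by (intro exI[of _ E]) auto
  next
    case False
    have "a \<in> \<Inter>C \<or> b \<in> \<Inter>C" if ab: "a * b \<in> \<Inter>C" for a b
    proof (rule ccontr)
      assume "\<not> (a \<in> \<Inter>C \<or> b \<in> \<Inter>C)"
      then have "{M \<in> C. a \<in> M} \<subset> C" "{M \<in> C. b \<in> M} \<subset> C" by auto
      then have "finite ({M \<in> C. a \<in> M} \<union> {M \<in> C. b \<in> M})"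
        using False mSpec_closed_Int_zeros[OF less.hyps] by blast
      moreover have "C \<subseteq> {M \<in> C. a \<in> M} \<union> {M \<in> C. b \<in> M}"
        using ab maximal_ideal_imp_prime[OF mSpec_closed_imp_maximal[OF less.hyps]]
        unfolding prime_ideal_def by blast
      ultimately show False using less.prems finite_subset by blast
    qed
    then have "prime_ideal (\<Inter>C)"
      using prime_ideal_Inter_closed[OF less.hyps] less.prems by auto
    then show ?thesis using less by blast
  qed
qed

text \<open>An infinite \<open>D\<close> would contain an infinite closed \<open>E\<close> with
  \<open>\<Inter>E\<close> prime; then \<open>\<Inter>C\<close>, \<open>\<Inter>E\<close> and a
  point of \<open>E\<close> would form a strict chain of three primes.\<close>

lemma finite_proper_closed_subset:
  fixes C :: "'r::comm_ring_1 set set"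
  assumes dim: "krull_dim_le_1 TYPE('r)" and noeth: "mSpec_noetherian TYPE('r)"
    and C: "mSpec_closed C" "prime_ideal (\<Inter>C)" and D: "mSpec_closed D" "D \<subset> C"
  shows "finite D"
proof (rule ccontr)
  assume "infinite D"
  then obtain E where E: "E \<subseteq> D" "mSpec_closed E" "infinite E" "prime_ideal (\<Inter>E)"
    using infinite_closed_contains_irreducible[OF noeth D(1)] by blast
  obtain M where M: "M \<in> E" using E(3) infinite_imp_nonempty by blast
  \<comment> \<open>The second point makes the inclusion of \<open>\<Inter>E\<close> in
    \<open>M\<close> strict.\<close>
  obtain M' where M': "M' \<in> E" "M' \<noteq> M"
    using infinite_imp_nonempty[OF infinite_remove[OF E(3), of M]] by blast
  have max: "maximal_ideal M" "maximal_ideal M'"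
    using M M' mSpec_closed_imp_maximal[OF E(2)] by auto
  obtain N where "N \<in> C" "N \<notin> E" using D E by blast
  then have "\<not> \<Inter>E \<subseteq> N" using mSpec_closed_mem_iff[OF E(2)] mSpec_closed_mem_iff[OF C(1)] by blast
  then have "\<Inter>C \<subset> \<Inter>E" using \<open>N \<in> C\<close> D E by blast
  moreover have "\<Inter>E \<subset> M"
    using M M' maximal_ideal_eqI[OF max] by blast
  ultimately show False
    using dim C(2) E(4) maximal_ideal_imp_prime[OF max(1)] unfolding krull_dim_le_1_def by blast
qed

text \<open>\<open>D\<close> stands for the complement in \<open>C\<close> of an open set containing
  \<open>G\<close>. One point tests an infinite irreducible \<open>C\<close>; a reducible one is
  covered by two smaller closed sets, whose test points are combined.\<close>

lemma ex_cofiniteness_test_points: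
  fixes C :: "'r::comm_ring_1 set set"
  assumes dim: "krull_dim_le_1 TYPE('r)" and noeth: "mSpec_noetherian TYPE('r)"
    and C: "mSpec_closed C" and F: "finite F"
  shows "\<exists>G\<subseteq>C. finite G \<and> G \<inter> F = {} \<and>
           (\<forall>D. mSpec_closed D \<longrightarrow> D \<subseteq> C \<longrightarrow> D \<inter> G = {} \<longrightarrow> finite D)"
  using noeth C
proof (induction C rule: mSpec_noetherian_induct)
  case (less C)
  show ?case
  proof (cases "finite C")
    case True
    then show ?thesis by (intro exI[of _ "{}"]) (auto intro: finite_subset)
  next
    case inf: False
    show ?thesis
    proof (cases "prime_ideal (\<Inter>C)")
      case True
      obtain p where p: "p \<in> C" "p \<notin> F"
        using infinite_imp_nonempty[OF Diff_infinite_finite[OF F inf]] by blast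
      have "finite D" if "mSpec_closed D" "D \<subseteq> C" "D \<inter> {p} = {}" for D
        using finite_proper_closed_subset[OF dim noeth less.hyps True that(1)] that p by blast
      then show ?thesis using p by (intro exI[of _ "{p}"]) auto
    next
      case False
      then obtain a b where ab: "a * b \<in> \<Inter>C" "a \<notin> \<Inter>C" "b \<notin> \<Inter>C"
        using prime_ideal_Inter_closed[OF less.hyps infinite_imp_nonempty[OF inf]] by blast
      let ?V = "\<lambda>c. {M \<in> C. c \<in> M}"
      have IH: "\<exists>G\<subseteq>?V c. finite G \<and> G \<inter> F = {} \<and>
           (\<forall>D. mSpec_closed D \<longrightarrow> D \<subseteq> ?V c \<longrightarrow> D \<inter> G = {} \<longrightarrow> finite D)" if "c \<notin> \<Inter>C" for c
        using that by (intro less.IH mSpec_closed_Int_zeros[OF less.hyps]) auto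
      obtain G1 where G1: "G1 \<subseteq> ?V a" "finite G1" "G1 \<inter> F = {}"
          "\<And>D. mSpec_closed D \<Longrightarrow> D \<subseteq> ?V a \<Longrightarrow> D \<inter> G1 = {} \<Longrightarrow> finite D"
        using IH[OF ab(2)] by (elim exE conjE) blast
      obtain G2 where G2: "G2 \<subseteq> ?V b" "finite G2" "G2 \<inter> F = {}"
          "\<And>D. mSpec_closed D \<Longrightarrow> D \<subseteq> ?V b \<Longrightarrow> D \<inter> G2 = {} \<Longrightarrow> finite D"
        using IH[OF ab(3)] by (elim exE conjE) blast
      have "finite D" if D: "mSpec_closed D" "D \<subseteq> C" "D \<inter> (G1 \<union> G2) = {}" for D
      proof -
        have "finite {M \<in> D. a \<in> M}" using D(2,3) by (intro G1(4) mSpec_closed_Int_zeros D(1)) auto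
        moreover have "finite {M \<in> D. b \<in> M}"
          using D(2,3) by (intro G2(4) mSpec_closed_Int_zeros D(1)) auto
        moreover have "D \<subseteq> {M \<in> D. a \<in> M} \<union> {M \<in> D. b \<in> M}"
          using ab(1) D(2) maximal_ideal_imp_prime[OF mSpec_closed_imp_maximal[OF less.hyps]]
          unfolding prime_ideal_def by blast
        ultimately show ?thesis by (meson finite_UnI finite_subset)
      qed
      then show ?thesis using G1(1-3) G2(1-3) by (intro exI[of _ "G1 \<union> G2"]) auto
    qed
  qed
qed

text \<open>Each \<open>q\<close> in \<open>T\<close> has an element outside \<open>p\<close>. The
  product of these stays outside the prime \<open>p\<close>, and an inverse modulo \<open>p\<close>
  normalises it to 1 there.\<close>

lemma ex_separating_element:
  assumes "finite T" "\<And>q. q \<in> T \<Longrightarrow> maximal_ideal q" "maximal_ideal p" "p \<notin> T"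
  shows "\<exists>e. (\<forall>q\<in>T. e \<in> q) \<and> 1 - e \<in> p"
proof -
  have prime: "prime_ideal p" by (rule maximal_ideal_imp_prime) fact
  have "\<exists>e. (\<forall>q\<in>T. e \<in> q) \<and> e \<notin> p"
    using assms(1,2,4)
  proof (induction T rule: finite_induct)
    case empty
    then show ?case using maximal_ideal_one_notin[OF assms(3)] by auto
  next
    case (insert q T)
    then obtain e where e: "\<forall>q\<in>T. e \<in> q" "e \<notin> p" by auto
    obtain x where x: "x \<in> q" "x \<notin> p"
      using insert.prems maximal_ideal_eqI[of q p] assms(3) by auto
    have "x * e \<in> q'" if "q' \<in> insert q T" for q'
    proof -
      have "ring_ideal q'" using insert.prems(1)[OF that] unfolding maximal_ideal_def by simp
      moreover have "x \<in> q' \<or> e \<in> q'" using that x e by blast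
      ultimately show ?thesis using ring_idealD(4) ring_ideal_mult_right by blast
    qed
    moreover have "x * e \<notin> p" using prime x e unfolding prime_ideal_def by blast
    ultimately show ?case by blast
  qed
  then obtain e where e: "\<forall>q\<in>T. e \<in> q" "e \<notin> p" by blast
  obtain y where "1 - y * e \<in> p" using maximal_ideal_inverse[OF assms(3) e(2)] .
  moreover have "y * e \<in> q" if "q \<in> T" for q
  proof -
    have "ring_ideal q" using assms(2)[OF that] unfolding maximal_ideal_def by simp
    then show ?thesis using e(1) that by (intro ring_idealD(4)) auto
  qed
  ultimately show ?thesis by blast
qed

section \<open>Algebras and their fibres\<close>

lemma sum_list_closed:
  assumes "0 \<in> N" "\<And>x y. x \<in> N \<Longrightarrow> y \<in> N \<Longrightarrow> x + y \<in> N" "\<And>x. x \<in> set l \<Longrightarrow> f x \<in> N"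
  shows "sum_list (map f l) \<in> N"
  using assms(3) by (induction l) (auto intro: assms(1,2))

locale algebra_map =
  fixes phi :: "'r::comm_ring_1 \<Rightarrow> 'a::ring_1"
  assumes algebra_map: "is_algebra_map phi"
begin

lemma phi_one: "phi 1 = 1"
  and phi_add: "phi (a + b) = phi a + phi b"
  and phi_mult: "phi (a * b) = phi a * phi b"
  and phi_central: "x * phi r = phi r * x"
  using algebra_map unfolding is_algebra_map_def by metis+

lemma phi_zero: "phi 0 = 0"
  using phi_add[of 0 0] by simp

lemma phi_uminus: "phi (- a) = - phi a"
  using phi_add[of a "- a"] phi_zero by (simp add: minus_unique)

lemma phi_diff: "phi (a - b) = phi a - phi b"
  using phi_add[of a "- b"] phi_uminus by simp

lemma phi_left_commute: "x * (phi r * y) = phi r * (x * y)"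
  by (metis mult.assoc phi_central)

text \<open>Unlike its generalisation above, this instance is permutative, hence terminates in \<open>simp\<close>.\<close>

lemma phi_phi_commute: "phi a * (phi b * y) = phi b * (phi a * y)"
  by (rule phi_left_commute)

section \<open>Submodules, spans and the ideal PA\<close>

definition submodule :: "'a set \<Rightarrow> bool" where
  "submodule N \<longleftrightarrow> 0 \<in> N \<and> (\<forall>x\<in>N. \<forall>y\<in>N. x + y \<in> N) \<and> (\<forall>c. \<forall>x\<in>N. phi c * x \<in> N)"

lemma submoduleD:
  assumes "submodule N"
  shows "0 \<in> N" "x \<in> N \<Longrightarrow> y \<in> N \<Longrightarrow> x + y \<in> N" "x \<in> N \<Longrightarrow> phi c * x \<in> N"
  using assms unfolding submodule_def by auto

lemma submodule_uminus: "submodule N \<Longrightarrow> x \<in> N \<Longrightarrow> - x \<in> N"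
  using submoduleD(3)[of N x "- 1"] by (simp add: phi_uminus phi_one)

lemma submodule_diff: "submodule N \<Longrightarrow> x \<in> N \<Longrightarrow> y \<in> N \<Longrightarrow> x - y \<in> N"
  using submoduleD(2)[of N x "- y"] submodule_uminus by simp

lemma submodule_rspan: "submodule (rspan phi S)"
  unfolding submodule_def
proof (intro conjI ballI allI)
  show "0 \<in> rspan phi S" unfolding rspan_def by (auto intro!: exI[of _ "[]"])
next
  fix x y assume "x \<in> rspan phi S" "y \<in> rspan phi S"
  then obtain l l' where l: "x = sum_list (map (\<lambda>(c, x). phi c * x) l)" "\<forall>(c, x) \<in> set l. x \<in> S"
    "y = sum_list (map (\<lambda>(c, x). phi c * x) l')" "\<forall>(c, x) \<in> set l'. x \<in> S"
    unfolding rspan_def by blast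
  show "x + y \<in> rspan phi S"
    unfolding rspan_def using l by (auto intro!: exI[of _ "l @ l'"])
next
  fix d x assume "x \<in> rspan phi S"
  then obtain l where l: "x = sum_list (map (\<lambda>(c, x). phi c * x) l)" "\<forall>(c, x) \<in> set l. x \<in> S"
    unfolding rspan_def by blast
  have "phi d * x = sum_list (map (\<lambda>(c, x). phi c * x) (map (\<lambda>(c, x). (d * c, x)) l))"
    unfolding l(1) by (induction l) (auto simp: phi_mult distrib_left mult.assoc)
  moreover have "\<forall>(c, x) \<in> set (map (\<lambda>(c, x). (d * c, x)) l). x \<in> S" using l(2) by auto
  ultimately show "phi d * x \<in> rspan phi S" unfolding rspan_def by blast
qed

lemma rspan_superset: "S \<subseteq> rspan phi S"
proof
  fix x assume "x \<in> S"
  then show "x \<in> rspan phi S"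
    unfolding rspan_def by (auto simp: phi_one intro!: exI[of _ "[(1, x)]"])
qed

lemma rspan_least:
  assumes "submodule N" "S \<subseteq> N" shows "rspan phi S \<subseteq> N"
proof
  fix x assume "x \<in> rspan phi S"
  then obtain l where l: "x = sum_list (map (\<lambda>(c, x). phi c * x) l)" "\<forall>(c, x) \<in> set l. x \<in> S"
    unfolding rspan_def by blast
  show "x \<in> N"
    unfolding l(1) using l(2) assms(2) submoduleD[OF assms(1)] by (intro sum_list_closed) auto
qed

lemma rspan_mono: "S \<subseteq> T \<Longrightarrow> rspan phi S \<subseteq> rspan phi T"
  using rspan_least[OF submodule_rspan] rspan_superset by blast

lemma ideal_times_mem: "c \<in> P \<Longrightarrow> phi c * x \<in> ideal_times phi P"
  unfolding ideal_times_def by (auto intro!: exI[of _ "[(c, x)]"])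

lemma ideal_times_least:
  assumes "0 \<in> N" "\<And>x y. x \<in> N \<Longrightarrow> y \<in> N \<Longrightarrow> x + y \<in> N" "\<And>c x. c \<in> P \<Longrightarrow> phi c * x \<in> N"
  shows "ideal_times phi P \<subseteq> N"
proof
  fix x assume "x \<in> ideal_times phi P"
  then obtain l where l: "x = sum_list (map (\<lambda>(c, x). phi c * x) l)" "\<forall>(c, x) \<in> set l. c \<in> P"
    unfolding ideal_times_def by blast
  show "x \<in> N"
    unfolding l(1) using l(2) by (intro sum_list_closed assms(1,2)) (auto intro: assms(3))
qed

lemma ideal_times_zero: "0 \<in> ideal_times phi P"
  unfolding ideal_times_def by (auto intro!: exI[of _ "[]"])

lemma ideal_times_add:
  assumes "x \<in> ideal_times phi P" "y \<in> ideal_times phi P" shows "x + y \<in> ideal_times phi P"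
proof -
  obtain l l' where l: "x = sum_list (map (\<lambda>(c, x). phi c * x) l)" "\<forall>(c, x) \<in> set l. c \<in> P"
    "y = sum_list (map (\<lambda>(c, x). phi c * x) l')" "\<forall>(c, x) \<in> set l'. c \<in> P"
    using assms unfolding ideal_times_def by blast
  show ?thesis
    unfolding ideal_times_def using l by (auto intro!: exI[of _ "l @ l'"])
qed

text \<open>Centrality of the scalars makes \<open>ideal_times phi P\<close> a two-sided
  ideal.\<close>

lemma ideal_times_mult:
  assumes "x \<in> ideal_times phi P"
  shows "a * x \<in> ideal_times phi P" "x * a \<in> ideal_times phi P"
proof -
  have "ideal_times phi P \<subseteq> {x. a * x \<in> ideal_times phi P \<and> x * a \<in> ideal_times phi P}"
    by (rule ideal_times_least)
      (auto simp: distrib_left distrib_right phi_left_commute mult.assoc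
        intro: ideal_times_zero ideal_times_add ideal_times_mem)
  then show "a * x \<in> ideal_times phi P" "x * a \<in> ideal_times phi P" using assms by auto
qed

lemma submodule_ideal_times: "submodule (ideal_times phi P)"
  unfolding submodule_def
  by (auto intro: ideal_times_zero ideal_times_add ideal_times_mult)

section \<open>Generation of the fibres\<close>

lemma generates_fibre_iff:
  "generates_fibre phi P as \<longleftrightarrow> (\<forall>x. \<exists>y\<in>rspan phi (monomials as). x - y \<in> ideal_times phi P)"
  unfolding generates_fibre_def by (metis add_diff_cancel_left' diff_add_cancel add.commute)

lemma monomials_mono: "set as \<subseteq> set bs \<Longrightarrow> monomials as \<subseteq> monomials bs"
  unfolding monomials_def by blast

lemma generates_fibre_mono:
  "generates_fibre phi P as \<Longrightarrow> set as \<subseteq> set bs \<Longrightarrow> generates_fibre phi P bs"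
  unfolding generates_fibre_def using rspan_mono[OF monomials_mono] by blast

text \<open>Factors are exchanged one at a time, each exchange changing the product by an element of
  a two-sided ideal.\<close>

lemma ex_congruent_monomial:
  assumes "\<forall>a\<in>set as. \<exists>b\<in>set bs. a - b \<in> ideal_times phi P" "set w \<subseteq> set as"
  shows "\<exists>w'. set w' \<subseteq> set bs \<and> prod_list w - prod_list w' \<in> ideal_times phi P"
  using assms(2)
proof (induction w)
  case Nil
  then show ?case by (intro exI[of _ "[]"]) (auto intro: ideal_times_zero)
next
  case (Cons a w)
  then obtain w' where w': "set w' \<subseteq> set bs" "prod_list w - prod_list w' \<in> ideal_times phi P"
    by auto
  obtain b where b: "b \<in> set bs" "a - b \<in> ideal_times phi P" using Cons.prems assms(1) by auto
  have "prod_list (a # w) - prod_list (b # w')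
      = a * (prod_list w - prod_list w') + (a - b) * prod_list w'"
    by (simp add: algebra_simps)
  also have "\<dots> \<in> ideal_times phi P"
    by (intro ideal_times_add ideal_times_mult w' b)
  finally show ?case using w' b by (intro exI[of _ "b # w'"]) auto
qed

text \<open>The elements congruent to some element of the span of the monomials in \<open>bs\<close>
  form a submodule containing the monomials in \<open>as\<close>. Hence generators of a fibre may be
  replaced by any other lifts.\<close>

lemma generates_fibre_cong:
  assumes "generates_fibre phi P as" "\<forall>a\<in>set as. \<exists>b\<in>set bs. a - b \<in> ideal_times phi P"
  shows "generates_fibre phi P bs"
proof -
  let ?N = "{y. \<exists>z\<in>rspan phi (monomials bs). y - z \<in> ideal_times phi P}"
  have "submodule ?N"
    unfolding submodule_def
  proof (intro conjI ballI allI)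
    show "0 \<in> ?N" using submoduleD(1)[OF submodule_rspan] ideal_times_zero by force
  next
    fix x y assume "x \<in> ?N" "y \<in> ?N"
    then obtain u v where "u \<in> rspan phi (monomials bs)" "v \<in> rspan phi (monomials bs)"
      "x - u \<in> ideal_times phi P" "y - v \<in> ideal_times phi P" by blast
    then have "u + v \<in> rspan phi (monomials bs)" "(x + y) - (u + v) \<in> ideal_times phi P"
      using submoduleD(2)[OF submodule_rspan] ideal_times_add[of "x - u" P "y - v"]
      by (auto simp: algebra_simps)
    then show "x + y \<in> ?N" by blast
  next
    fix c x assume "x \<in> ?N"
    then obtain u where "u \<in> rspan phi (monomials bs)" "x - u \<in> ideal_times phi P" by blast
    then have "phi c * u \<in> rspan phi (monomials bs)" "phi c * x - phi c * u \<in> ideal_times phi P"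
      using submoduleD(3)[OF submodule_rspan] ideal_times_mult(1)[of "x - u" P "phi c"]
      by (auto simp: algebra_simps)
    then show "phi c * x \<in> ?N" by blast
  qed
  moreover have "monomials as \<subseteq> ?N"
  proof
    fix y assume "y \<in> monomials as"
    then obtain w where w: "y = prod_list w" "set w \<subseteq> set as" unfolding monomials_def by blast
    obtain w' where "set w' \<subseteq> set bs" "prod_list w - prod_list w' \<in> ideal_times phi P"
      using ex_congruent_monomial[OF assms(2) w(2)] by blast
    moreover from this(1) have "prod_list w' \<in> monomials bs" unfolding monomials_def by blast
    then have "prod_list w' \<in> rspan phi (monomials bs)" using rspan_superset by (rule rev_subsetD)
    ultimately show "y \<in> ?N" unfolding w(1) by blast
  qed
  ultimately have sub: "rspan phi (monomials as) \<subseteq> ?N" by (rule rspan_least)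
  show ?thesis
    unfolding generates_fibre_iff
  proof
    fix x
    obtain y where y: "y \<in> rspan phi (monomials as)" "x - y \<in> ideal_times phi P"
      using assms(1) unfolding generates_fibre_iff by blast
    then obtain z where z: "z \<in> rspan phi (monomials bs)" "y - z \<in> ideal_times phi P"
      using sub by blast
    have "x - z \<in> ideal_times phi P" using ideal_times_add[OF y(2) z(2)] by simp
    then show "\<exists>z\<in>rspan phi (monomials bs). x - z \<in> ideal_times phi P" using z by blast
  qed
qed

lemma chinese_remainder_fibres:
  assumes "finite T" "\<And>p. p \<in> T \<Longrightarrow> maximal_ideal p"
  shows "\<exists>a. \<forall>p\<in>T. f p - a \<in> ideal_times phi p"
  using assms
proof (induction T rule: finite_induct)
  case (insert p T)
  then obtain a where a: "\<forall>p\<in>T. f p - a \<in> ideal_times phi p" by auto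
  obtain e where e: "\<forall>q\<in>T. e \<in> q" "1 - e \<in> p"
    using ex_separating_element[of T p] insert by auto
  \<comment> \<open>The correction vanishes modulo each \<open>q\<close> in \<open>T\<close>, as
    \<open>e\<close> lies in \<open>q\<close>, and turns \<open>a\<close> into \<open>f p\<close>
    modulo \<open>p\<close>, where \<open>e\<close> is 1.\<close>
  let ?a = "a + phi e * (f p - a)"
  have "f p - ?a = phi (1 - e) * (f p - a)" by (simp add: phi_diff phi_one algebra_simps)
  then have "f p - ?a \<in> ideal_times phi p" using e(2) ideal_times_mem by metis
  moreover have "f q - ?a \<in> ideal_times phi q" if "q \<in> T" for q
  proof -
    have "(f q - a) - phi e * (f p - a) \<in> ideal_times phi q"
      using a e that by (blast intro: submodule_diff[OF submodule_ideal_times] ideal_times_mem)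
    then show ?thesis by (simp add: algebra_simps)
  qed
  ultimately show ?case by blast
qed simp

section \<open>Nakayama's lemma\<close>

text \<open>Unlike in \<open>ideal_times\<close>, each list entry gets exactly one coefficient from
  \<open>P\<close>, so the term of the head can be split off when generators are eliminated.\<close>

primrec lincombs :: "'r set \<Rightarrow> 'a list \<Rightarrow> 'a set" where
  "lincombs P [] = {0}"
| "lincombs P (x # xs) = {phi p * x + z | p z. p \<in> P \<and> z \<in> lincombs P xs}"

lemma submodule_lincombs:
  assumes "ring_ideal P" shows "submodule (lincombs P xs)"
proof (induction xs)
  case Nil
  then show ?case unfolding submodule_def by simp
next
  case (Cons x xs)
  show ?case
    unfolding submodule_def
  proof (intro conjI ballI allI)
    have "0 = phi 0 * x + 0" "0 \<in> P" "0 \<in> lincombs P xs"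
      using ring_idealD(1)[OF assms] submoduleD(1)[OF Cons] by (auto simp: phi_zero)
    then show "0 \<in> lincombs P (x # xs)" unfolding lincombs.simps by blast
  next
    fix u v assume "u \<in> lincombs P (x # xs)" "v \<in> lincombs P (x # xs)"
    then obtain p q y z where *: "u = phi p * x + y" "v = phi q * x + z" "p \<in> P" "q \<in> P"
      "y \<in> lincombs P xs" "z \<in> lincombs P xs" by auto
    then have "u + v = phi (p + q) * x + (y + z)" by (simp add: phi_add algebra_simps)
    then show "u + v \<in> lincombs P (x # xs)"
      unfolding lincombs.simps using * ring_idealD(2)[OF assms] submoduleD(2)[OF Cons] by blast
  next
    fix c u assume "u \<in> lincombs P (x # xs)"
    then obtain p y where *: "u = phi p * x + y" "p \<in> P" "y \<in> lincombs P xs" by auto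
    then have "phi c * u = phi (c * p) * x + phi c * y" by (simp add: phi_mult algebra_simps)
    then show "phi c * u \<in> lincombs P (x # xs)"
      unfolding lincombs.simps using * ring_idealD(4)[OF assms] submoduleD(3)[OF Cons] by blast
  qed
qed

lemma lincombs_mem:
  assumes P: "ring_ideal P" and "c \<in> P" "x \<in> set xs" shows "phi c * x \<in> lincombs P xs"
  using assms(3)
proof (induction xs)
  case (Cons y xs)
  have y: "phi c * y = phi c * y + 0" and x: "phi c * x = phi 0 * y + phi c * x"
    by (simp_all add: phi_zero)
  have "0 \<in> P" "0 \<in> lincombs P xs"
    using ring_idealD(1)[OF P] submoduleD(1)[OF submodule_lincombs[OF P]] by auto
  moreover have "x = y \<or> phi c * x \<in> lincombs P xs" using Cons by auto
  ultimately show ?case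
    unfolding lincombs.simps using x y \<open>c \<in> P\<close> by blast
qed simp

text \<open>Multiplying a combination of the generators \<open>xs\<close> by an element of
  \<open>P\<close> puts all its coefficients into \<open>P\<close>.\<close>

lemma ideal_times_subset_lincombs:
  assumes P: "ring_ideal P" and xs: "rspan phi (set xs) = UNIV"
  shows "ideal_times phi P \<subseteq> lincombs P xs"
proof (rule ideal_times_least)
  note sub = submodule_lincombs[OF P, of xs]
  fix c x assume c: "c \<in> P"
  let ?N = "{x. phi c * x \<in> lincombs P xs}"
  have "submodule ?N"
    using submoduleD[OF sub] unfolding submodule_def by (auto simp: distrib_left phi_phi_commute)
  then have "rspan phi (set xs) \<subseteq> ?N"
    using lincombs_mem[OF P c] by (intro rspan_least) auto
  then show "phi c * x \<in> lincombs P xs" using xs by blast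
qed (use submoduleD[OF submodule_lincombs[OF P]] in auto)

text \<open>Nakayama's lemma for the localisation at \<open>P\<close>, with denominators cleared. Allowing a
  denominator in the hypothesis as well lets the generators be eliminated one at a time.\<close>

lemma nakayama_denominators:
  assumes P: "prime_ideal P" and N: "submodule N"
    and "\<And>x. x \<in> set xs \<Longrightarrow> \<exists>u n z. u \<notin> P \<and> n \<in> N \<and> z \<in> lincombs P xs \<and> phi u * x = n + z"
  shows "\<exists>s. s \<notin> P \<and> (\<forall>x\<in>set xs. phi s * x \<in> N)"
  using assms(3)
proof (induction xs)
  case Nil
  then show ?case using P unfolding prime_ideal_def by auto
next
  case (Cons x xs)
  have I: "ring_ideal P" using P unfolding prime_ideal_def by simp
  have prime: "a * b \<notin> P" if "a \<notin> P" "b \<notin> P" for a b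
    using P that unfolding prime_ideal_def by blast
  note sub = submoduleD[OF N] submoduleD[OF submodule_lincombs[OF I]]
  obtain u n p z where x: "u \<notin> P" "n \<in> N" "p \<in> P" "z \<in> lincombs P xs"
    "phi u * x = n + (phi p * x + z)"
    using Cons.prems[of x] by auto
  \<comment> \<open>The term \<open>phi p * x\<close> moves to the left; \<open>t\<close> avoids
    \<open>P\<close> because \<open>p\<close> lies in \<open>P\<close> and \<open>u\<close> does
    not.\<close>
  define t where "t = u - p"
  have t: "t \<notin> P" using x ring_idealD(2)[OF I, of t p] unfolding t_def by auto
  have tx: "phi t * x = n + z" using x(5) unfolding t_def by (simp add: phi_diff algebra_simps)
  have "\<exists>u n z. u \<notin> P \<and> n \<in> N \<and> z \<in> lincombs P xs \<and> phi u * y = n + z" if mem: "y \<in> set xs" for y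
  proof -
    obtain v m q w where y: "v \<notin> P" "m \<in> N" "q \<in> P" "w \<in> lincombs P xs"
      "phi v * y = m + (phi q * x + w)"
      using Cons.prems[OF list.set_intros(2)[OF mem]] by auto
    \<comment> \<open>After multiplication by \<open>t\<close>, the fact \<open>tx\<close>
      eliminates \<open>x\<close> from the relation for \<open>y\<close>; the new denominator
      \<open>t * v\<close> avoids \<open>P\<close> by primality.\<close>
    have "phi (t * v) * y = phi t * (phi v * y)" by (simp add: phi_mult mult.assoc)
    also have "\<dots> = phi t * m + phi q * (phi t * x) + phi t * w"
      unfolding y(5) by (simp add: distrib_left phi_phi_commute add.assoc)
    also have "\<dots> = (phi t * m + phi q * n) + (phi q * z + phi t * w)"
      unfolding tx by (simp add: algebra_simps)
    finally have "phi (t * v) * y = (phi t * m + phi q * n) + (phi q * z + phi t * w)" .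
    moreover have "phi t * m + phi q * n \<in> N" using x(2) y(2) by (intro sub)
    moreover have "phi q * z + phi t * w \<in> lincombs P xs" using x(4) y(4) by (intro sub)
    ultimately show ?thesis using prime[OF t y(1)] by blast
  qed
  then obtain s where s: "s \<notin> P" "\<forall>x\<in>set xs. phi s * x \<in> N" using Cons.IH by blast
  \<comment> \<open>\<open>s\<close> carries the generators in \<open>xs\<close> into
    \<open>N\<close>, hence also their combination \<open>z\<close>.\<close>
  have "lincombs Q ys \<subseteq> {z. phi s * z \<in> N}" if "\<forall>x\<in>set ys. phi s * x \<in> N" for Q ys
    using that sub(1-3) by (induction ys) (auto simp: distrib_left phi_phi_commute)
  then have "phi s * z \<in> N" using s(2) x(4) by blast
  then have "phi s * (phi t * x) \<in> N" unfolding tx using sub x(2) by (simp add: distrib_left)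
  moreover have "phi s * (phi t * y) \<in> N" if "y \<in> set xs" for y
    using s(2) that sub(3) by (metis phi_left_commute)
  ultimately show ?case using prime[OF s(1) t]
    by (intro exI[of _ "s * t"]) (auto simp: phi_mult mult.assoc)
qed

section \<open>The conductor and the local-global principle\<close>

text \<open>The annihilator of the quotient of the module \<open>A\<close> by the span of the
  monomials in \<open>as\<close>.\<close>

definition conductor :: "'a list \<Rightarrow> 'r set" where
  "conductor as = {s. \<forall>x. phi s * x \<in> rspan phi (monomials as)}"

lemma ring_ideal_conductor: "ring_ideal (conductor as)"
  using submoduleD[OF submodule_rspan] submodule_uminus[OF submodule_rspan]
  unfolding ring_ideal_def conductor_def
  by (auto simp: phi_zero phi_add phi_uminus phi_mult distrib_right mult.assoc)

text \<open>Nakayama's lemma gives a scalar outside \<open>P\<close> carrying \<open>A\<close> into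
  the span. Conversely, such a scalar is invertible modulo \<open>P\<close>, so every element is
  congruent to one of the span. Generation thus becomes an open condition on
  \<open>P\<close>.\<close>

lemma generates_fibre_iff_conductor:
  assumes fin: "finitely_generated_module phi" and P: "maximal_ideal P"
  shows "generates_fibre phi P as \<longleftrightarrow> \<not> conductor as \<subseteq> P"
proof
  assume gen: "generates_fibre phi P as"
  have prime: "prime_ideal P" and I: "ring_ideal P"
    using P maximal_ideal_imp_prime unfolding maximal_ideal_def by auto
  obtain xs where xs: "rspan phi (set xs) = UNIV"
    using fin finite_list unfolding finitely_generated_module_def by metis
  let ?N = "rspan phi (monomials as)"
  have "\<exists>u n z. u \<notin> P \<and> n \<in> ?N \<and> z \<in> lincombs P xs \<and> phi u * x = n + z" for x
  proof -
    obtain n z where "n \<in> ?N" "z \<in> ideal_times phi P" "x = n + z"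
      using gen unfolding generates_fibre_def by blast
    then show ?thesis
      using ideal_times_subset_lincombs[OF I xs] maximal_ideal_one_notin[OF P] phi_one
      by (metis mult_1 subsetD)
  qed
  then obtain s where s: "s \<notin> P" "\<forall>x\<in>set xs. phi s * x \<in> ?N"
    using nakayama_denominators[OF prime submodule_rspan] by metis
  have "submodule {x. phi s * x \<in> ?N}"
    using submoduleD[OF submodule_rspan]
    unfolding submodule_def by (auto simp: distrib_left phi_phi_commute)
  then have "rspan phi (set xs) \<subseteq> {x. phi s * x \<in> ?N}" using s(2) by (intro rspan_least) auto
  then have "s \<in> conductor as" using xs unfolding conductor_def by blast
  then show "\<not> conductor as \<subseteq> P" using s(1) by blast
next
  assume "\<not> conductor as \<subseteq> P"
  then obtain s where s: "s \<in> conductor as" "s \<notin> P" by blast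
  obtain t where t: "1 - t * s \<in> P" using maximal_ideal_inverse[OF P s(2)] .
  have "t * s \<in> conductor as" using s(1) ring_idealD(4)[OF ring_ideal_conductor] by blast
  moreover have "x - phi (t * s) * x = phi (1 - t * s) * x" for x
    by (simp add: phi_diff phi_one left_diff_distrib)
  ultimately show "generates_fibre phi P as"
    unfolding generates_fibre_iff conductor_def using ideal_times_mem[OF t]
    by (metis (no_types, lifting) mem_Collect_eq)
qed

text \<open>No maximal ideal contains the conductor, so the conductor contains 1.\<close>

lemma generates_algebra_local_global:
  assumes fin: "finitely_generated_module phi"
    and "\<And>P. maximal_ideal P \<Longrightarrow> generates_fibre phi P as"
  shows "generates_algebra phi as"
proof -
  have "1 \<in> conductor as"
    using ex_maximal_ideal_superset[OF ring_ideal_conductor] assms(2)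
      generates_fibre_iff_conductor[OF fin] by blast
  then show ?thesis unfolding generates_algebra_def conductor_def by (auto simp: phi_one)
qed

section \<open>Adding generators one at a time\<close>

text \<open>For maximal \<open>P\<close> this is the bound \<open>e\<^sub>p(a) \<le> n\<close>;
  asking for exactly \<open>n\<close> further elements does no harm, since zeros can be
  appended.\<close>

definition completable :: "'a list \<Rightarrow> nat \<Rightarrow> 'r set \<Rightarrow> bool" where
  "completable as n P \<longleftrightarrow> (\<exists>bs. length bs = n \<and> generates_fibre phi P (as @ bs))"

lemma completable_mono:
  assumes "completable as m P" "m \<le> n" shows "completable as n P"
proof -
  obtain bs where bs: "length bs = m" "generates_fibre phi P (as @ bs)"
    using assms unfolding completable_def by blast
  then have "generates_fibre phi P (as @ (bs @ replicate (n - m) 0))"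
    by (elim generates_fibre_mono) auto
  moreover have "length (bs @ replicate (n - m) 0) = n" using bs assms by simp
  ultimately show ?thesis unfolding completable_def by blast
qed

lemma completable_snoc:
  assumes "completable as n P" shows "completable (as @ [a]) n P"
proof -
  obtain bs where "length bs = n" "generates_fibre phi P (as @ bs)"
    using assms unfolding completable_def by blast
  moreover from this(2) have "generates_fibre phi P ((as @ [a]) @ bs)"
    by (elim generates_fibre_mono) auto
  ultimately show ?thesis unfolding completable_def by blast
qed

text \<open>\<open>b\<close> is the first of the missing generators. That only its class matters
  leaves the freedom to treat several \<open>P\<close> at once.\<close>

lemma completable_Suc_imp:
  assumes "completable as (Suc n) P"
  shows "\<exists>b. \<forall>a. b - a \<in> ideal_times phi P \<longrightarrow> completable (as @ [a]) n P"
proof -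
  obtain b bs where b: "length bs = n" "generates_fibre phi P (as @ b # bs)"
    using assms unfolding completable_def by (metis length_Suc_conv)
  have "generates_fibre phi P ((as @ [a]) @ bs)" if "b - a \<in> ideal_times phi P" for a
    using b(2) by (rule generates_fibre_cong) (use that ideal_times_zero in force)
  then show ?thesis using b(1) unfolding completable_def by blast
qed

text \<open>Elements chosen fibre by fibre are merged by the Chinese remainder theorem.\<close>

lemma ex_snoc_completable:
  assumes "finite T"
    and "\<And>P. P \<in> T \<Longrightarrow> maximal_ideal P \<and> (\<exists>n. completable as (Suc n) P)"
  shows "\<exists>a. \<forall>P\<in>T. \<forall>n. completable as (Suc n) P \<longrightarrow> completable (as @ [a]) n P"
proof -
  have "\<exists>b. \<forall>a. b - a \<in> ideal_times phi P \<longrightarrow>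
          (\<forall>n. completable as (Suc n) P \<longrightarrow> completable (as @ [a]) n P)" if "P \<in> T" for P
  proof -
    have ex: "\<exists>n. completable as (Suc n) P" using assms(2)[OF that] by blast
    \<comment> \<open>The element chosen for the least \<open>m\<close> serves every admissible
      \<open>n\<close>, by monotonicity.\<close>
    define m where "m = (LEAST n. completable as (Suc n) P)"
    have "completable as (Suc m) P" unfolding m_def using ex by (rule LeastI_ex)
    moreover have "m \<le> n" if "completable as (Suc n) P" for n
      unfolding m_def using that by (rule Least_le)
    ultimately show ?thesis using completable_Suc_imp completable_mono by meson
  qed
  then obtain f where f: "\<And>P a. P \<in> T \<Longrightarrow> f P - a \<in> ideal_times phi P \<Longrightarrow>
      \<forall>n. completable as (Suc n) P \<longrightarrow> completable (as @ [a]) n P" by metis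
  obtain a where "\<forall>P\<in>T. f P - a \<in> ideal_times phi P"
    using chinese_remainder_fibres[of T f] assms by blast
  then show ?thesis using f by blast
qed

text \<open>\<open>P\<close> fails exactly when it contains the conductors of \<open>as @ bs\<close>
  for all \<open>bs\<close> of length \<open>n\<close>, that is, when it contains their
  union.\<close>

lemma mSpec_closed_not_completable:
  assumes "finitely_generated_module phi"
  shows "mSpec_closed {P \<in> mSpec. \<not> completable as n P}"
proof -
  have "{P \<in> mSpec. \<not> completable as n P}
      = {P \<in> mSpec. (\<Union>bs\<in>{bs. length bs = n}. conductor (as @ bs)) \<subseteq> P}"
    unfolding completable_def mSpec_def using generates_fibre_iff_conductor[OF assms] by auto
  then show ?thesis unfolding mSpec_closed_def by blast
qed

text \<open>Induction on \<open>m\<close> with \<open>as\<close> and \<open>n\<close> arbitrary: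
  each new element joins \<open>as\<close> and lowers both bounds, the second no further than 0. At
  \<open>m = 0\<close> every fibre is generated, and the local-global principle applies.\<close>

lemma ex_generating_extension:
  assumes dim: "krull_dim_le_1 TYPE('r)" and noeth: "mSpec_noetherian TYPE('r)"
    and fin: "finitely_generated_module phi"
    and "\<forall>P\<in>mSpec. completable as m P"
    and "finite {P \<in> mSpec. \<not> completable as n P}"
    and "n < m \<or> n = 0"
  shows "\<exists>bs. length bs = m \<and> generates_algebra phi (as @ bs)"
  using assms(4-6)
proof (induction m arbitrary: as n)
  case 0
  then show ?case
    using generates_algebra_local_global[OF fin, of as] unfolding completable_def mSpec_def by auto
next
  case (Suc m)
  let ?F = "{P \<in> mSpec. \<not> completable as n P}"
  have "mSpec_closed (mSpec :: 'r set set)" unfolding mSpec_closed_def by blast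
  \<comment> \<open>As \<open>G\<close> avoids \<open>?F\<close>, its points are completable by
    \<open>n\<close> elements, and the next element can lower a positive \<open>n\<close>
    there.\<close>
  then obtain G where G: "G \<subseteq> mSpec" "finite G" "G \<inter> ?F = {}"
    and cofin: "\<And>D. mSpec_closed D \<Longrightarrow> D \<subseteq> mSpec \<Longrightarrow> D \<inter> G = {} \<Longrightarrow> finite D"
    using ex_cofiniteness_test_points[OF dim noeth _ Suc.prems(2)] by metis
  have T_fin: "finite (?F \<union> G)" using Suc.prems(2) G(2) by blast
  have T: "maximal_ideal P \<and> (\<exists>n. completable as (Suc n) P)" if "P \<in> ?F \<union> G" for P
    using that G(1) Suc.prems(1) unfolding mSpec_def by blast
  obtain a where
    a: "\<forall>P\<in>?F \<union> G. \<forall>n. completable as (Suc n) P \<longrightarrow> completable (as @ [a]) n P"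
    using exE[OF ex_snoc_completable[OF T_fin T]] .
  have "completable (as @ [a]) m P" if "P \<in> mSpec" for P
  proof (cases "P \<in> ?F")
    case True
    then show ?thesis using a Suc.prems(1) by blast
  next
    case False
    then have "completable (as @ [a]) n P" using that completable_snoc by blast
    \<comment> \<open>Either alternative of the last premise gives \<open>n \<le> m\<close>.\<close>
    then show ?thesis by (rule completable_mono) (use Suc.prems(3) in auto)
  qed
  \<comment> \<open>Truncated subtraction unites two cases: \<open>n = 0\<close> is merely
    preserved, while for positive \<open>n\<close> the new exceptional set is closed and misses
    \<open>G\<close>.\<close>
  moreover have "finite {P \<in> mSpec. \<not> completable (as @ [a]) (n - 1) P}"
  proof (cases n)
    case 0
    then show ?thesis using Suc.prems(2) completable_snoc
      by (elim finite_subset[rotated]) auto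
  next
    case (Suc n')
    then have "completable (as @ [a]) n' P" if "P \<in> G" for P
      using a G that by blast
    then show ?thesis
      unfolding Suc by (intro cofin mSpec_closed_not_completable[OF fin]) auto
  qed
  moreover have "n - 1 < m \<or> n - 1 = 0" using Suc.prems(3) by linarith
  ultimately obtain bs where "length bs = m" "generates_algebra phi ((as @ [a]) @ bs)"
    using Suc.IH by blast
  then show ?case by (intro exI[of _ "a # bs"]) auto
qed

text \<open>Module generators are monomials of length one. This ensures that the minimum defining
  \<open>fibre_rank\<close> is attained.\<close>

lemma ex_generates_fibre:
  assumes "finitely_generated_module phi" shows "\<exists>as. generates_fibre phi P as"
proof -
  obtain xs where xs: "rspan phi (set xs) = UNIV"
    using assms finite_list unfolding finitely_generated_module_def by metis
  have "set xs \<subseteq> monomials xs"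
  proof
    fix x assume "x \<in> set xs"
    then show "x \<in> monomials xs" unfolding monomials_def by (auto intro!: exI[of _ "[x]"])
  qed
  then have "rspan phi (monomials xs) = UNIV" using rspan_mono xs by blast
  then have "generates_fibre phi P xs"
    unfolding generates_fibre_iff by (metis UNIV_I diff_self ideal_times_zero)
  then show ?thesis by blast
qed

lemma completable_fibre_rank:
  assumes "finitely_generated_module phi" "fibre_rank phi P \<le> n" shows "completable [] n P"
proof -
  have "completable [] (fibre_rank phi P) P"
    unfolding completable_def fibre_rank_def append_Nil
    by (rule LeastI_ex) (use ex_generates_fibre[OF assms(1)] in blast)
  then show ?thesis using assms(2) by (rule completable_mono)
qed

end

theorem mainTheorem5:
  fixes phi :: "'r::comm_ring_1 \<Rightarrow> 'a::ring_1"
    and h k :: nat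
  assumes "krull_dim_le_1 TYPE('r)"
    and "mSpec_noetherian TYPE('r)"
    and "is_algebra_map phi"
    and "finitely_generated_module phi"
    and "h = (LEAST h. finite {P. maximal_ideal P \<and> h < fibre_rank phi P})"
    and "\<forall>P. maximal_ideal P \<longrightarrow> fibre_rank phi P \<le> k"
    and "1 + h \<le> k"
  shows "\<exists>as. length as = k \<and> generates_algebra phi as"
proof -
  interpret algebra_map phi by unfold_locales fact
  \<comment> \<open>The \<open>LEAST\<close> defining \<open>h\<close> is attained because some
    value qualifies: \<open>k\<close> does, with no exceptional ideals.\<close>
  have "{P. maximal_ideal P \<and> k < fibre_rank phi P} = {}" using assms(6) by (auto simp: not_less)
  then have "finite {P. maximal_ideal P \<and> k < fibre_rank phi P}" by (simp only: finite.emptyI)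
  then have "finite {P. maximal_ideal P \<and> h < fibre_rank phi P}"
    unfolding assms(5) by (rule LeastI)
  moreover have "{P \<in> mSpec. \<not> completable [] h P} \<subseteq> {P. maximal_ideal P \<and> h < fibre_rank phi P}"
    using completable_fibre_rank[OF assms(4)] not_less unfolding mSpec_def by blast
  ultimately have "finite {P \<in> mSpec. \<not> completable [] h P}" by (rule rev_finite_subset)
  moreover have "\<forall>P\<in>mSpec. completable [] k P"
    using assms(6) completable_fibre_rank[OF assms(4)] unfolding mSpec_def by blast
  \<comment> \<open>The construction starts from the empty list, and \<open>1 + h \<le> k\<close>
    supplies \<open>h < k\<close>.\<close>
  ultimately show ?thesis
    using ex_generating_extension[OF assms(1,2,4), of "[]" k h] assms(7) by auto
qed

end
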